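(* If $(X,T,\varphi)$ is a flip system, then for every $m=1,2,\dots$, $$p_{2m-1,0}(T,\varphi)=p_{2m-1,0}(T,T\circ\varphi),$$ $$p_{2m,0}(T,\varphi)=p_{2m,1}(T,T\circ\varphi),$$ $$p_{2m,1}(T,\varphi)=p_{2m,0}(T,T\circ\varphi).$$ As a consequence, the Lind zeta functions of $(X,T,\varphi)$ and $(X,T,T\circ\varphi)$ are the same.
   Context: Let $T$ be a homeomorphism of a topological space $X$. A flip for $(X,T)$ is a homeomorphism $\varphi:X\to X$ with $\varphi\circ T=T^{-1}\circ\varphi$ and $\varphi^2=\mathrm{id}_X$; then $(X,T,\varphi)$ is called a flip system. If $(X,T,\varphi)$ is a flip system, so is $(X,T,T\circ\varphi)$. For a positive integer $m$ and an integer $n$, $p_{m,n}(T,\varphi)=|\{x\in X: T^m(x)=T^n\circ\varphi(x)=x\}|$. For an action $\alpha$ of a group $G$ on a set $X$, let $\mathcal{F}$ be the set of finite index subgroups of $G$, and for $H\in\mathcal{F}$ let $p_H(\alpha)=|\{x\in X:\alpha(h,x)=x\ \text{for all } h\in H\}|$. The Lind zeta function of $\alpha$ is the formal power series $\zeta_\alpha(t)=\exp\left(\sum_{H\in\mathcal{F}}\frac{p_H(\alpha)}{|G/H|}t^{|G/H|}\right)$ (the notion presupposes that the numbers $p_H(\alpha)$ are finite). Let $D_\infty=\langle a,b: ab=ba^{-1},\ b^2=1\rangle$. The Lind zeta function of a flip system $(X,T,\varphi)$ is that of the $D_\infty$-action $\alpha$ on $X$ determined by $\alpha(a,x)=T(x)$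 and $\alpha(b,x)=\varphi(x)$. *)

theory Defs
  imports "HOL-Analysis.Analysis" "HOL-Algebra.Left_Coset" "HOL-Algebra.Group_Action"
    "HOL-Computational_Algebra.Formal_Power_Series"
begin

unbundle cardinal_syntax

definition flip_system :: "'a topology \<Rightarrow> ('a \<Rightarrow> 'a) \<Rightarrow> ('a \<Rightarrow> 'a) \<Rightarrow> bool" where
  "flip_system X T \<phi> \<longleftrightarrow>
     homeomorphic_map X X T \<and> homeomorphic_map X X \<phi> \<and>
     (\<forall>x \<in> topspace X. \<phi> (T x) = inv_into (topspace X) T (\<phi> x)) \<and>
     (\<forall>x \<in> topspace X. \<phi> (\<phi> x) = x)"

(* Integer powers of T are powers in the group of bijections of the space. Its elements are
   extensional functions, hence the restriction. *)
definition int_iterate :: "'a topology \<Rightarrow> ('a \<Rightarrow> 'a) \<Rightarrow> int \<Rightarrow> 'a \<Rightarrow> 'a" where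
  "int_iterate X T n = restrict T (topspace X) [^]\<^bsub>BijGroup (topspace X)\<^esub> n"

(* A cardinal rather than a natural number, as the set may be infinite; equality of
   cardinals is =o. *)
definition flip_points :: "'a topology \<Rightarrow> ('a \<Rightarrow> 'a) \<Rightarrow> ('a \<Rightarrow> 'a) \<Rightarrow> nat \<Rightarrow> int \<Rightarrow> 'a rel" where
  "flip_points X T \<phi> m n =
     |{x \<in> topspace X. (T ^^ m) x = x \<and> int_iterate X T n (\<phi> x) = x}|"

definition finite_index_subgroups :: "('g, 'c) monoid_scheme \<Rightarrow> 'g set set" where
  "finite_index_subgroups G = {H. subgroup H G \<and> finite (lcosets\<^bsub>G\<^esub> H)}"

definition common_fixed_points :: "'a set \<Rightarrow> ('g \<Rightarrow> 'a \<Rightarrow> 'a) \<Rightarrow> 'g set \<Rightarrow> 'a set" where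
  "common_fixed_points E \<alpha> H = {x \<in> E. \<forall>h \<in> H. \<alpha> h x = x}"

(* The infinite sum is taken in the X-adic topology of formal power series. *)
definition lind_zeta ::
    "('g, 'c) monoid_scheme \<Rightarrow> 'a set \<Rightarrow> ('g \<Rightarrow> 'a \<Rightarrow> 'a) \<Rightarrow> rat fps" where
  "lind_zeta G E \<alpha> = fps_compose (fps_exp 1)
     (\<Sum>\<^sub>\<infinity>H \<in> finite_index_subgroups G.
        fps_const (of_nat (card (common_fixed_points E \<alpha> H)) / of_nat (card (lcosets\<^bsub>G\<^esub> H)))
          * fps_X ^ card (lcosets\<^bsub>G\<^esub> H))"

(* The pair (i, s) stands for a^i b^s. *)
definition Dinf :: "(int \<times> bool) monoid" where
  "Dinf = \<lparr>carrier = UNIV,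
     mult = (\<lambda>(i, s) (j, t). (if s then i - j else i + j, s \<noteq> t)),
     one = (0, False)\<rparr>"

definition Dinf_a :: "int \<times> bool" where "Dinf_a = (1, False)"
definition Dinf_b :: "int \<times> bool" where "Dinf_b = (0, True)"

definition Dinf_lift :: "('g, 'c) monoid_scheme \<Rightarrow> 'g \<Rightarrow> 'g \<Rightarrow> int \<times> bool \<Rightarrow> 'g" where
  "Dinf_lift G x y = (\<lambda>(i, s). x [^]\<^bsub>G\<^esub> i \<otimes>\<^bsub>G\<^esub> (if s then y else \<one>\<^bsub>G\<^esub>))"

definition flip_action ::
    "'a topology \<Rightarrow> ('a \<Rightarrow> 'a) \<Rightarrow> ('a \<Rightarrow> 'a) \<Rightarrow> int \<times> bool \<Rightarrow> 'a \<Rightarrow> 'a" where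
  "flip_action X T \<phi> =
     Dinf_lift (BijGroup (topspace X)) (restrict T (topspace X)) (restrict \<phi> (topspace X))"


lemma Dinf_carrier: "x \<in> carrier Dinf"
  by (simp add: Dinf_def)

lemma Dinf_mult: "(i, s) \<otimes>\<^bsub>Dinf\<^esub> (j, t) = (if s then i - j else i + j, s \<noteq> t)"
  by (simp add: Dinf_def)

lemma Dinf_one: "\<one>\<^bsub>Dinf\<^esub> = (0, False)"
  by (simp add: Dinf_def)

lemma group_Dinf: "group Dinf"
proof (rule groupI)
  fix x y z :: "int \<times> bool"
  show "x \<otimes>\<^bsub>Dinf\<^esub> y \<otimes>\<^bsub>Dinf\<^esub> z = x \<otimes>\<^bsub>Dinf\<^esub> (y \<otimes>\<^bsub>Dinf\<^esub> z)"
    by (cases x; cases y; cases z) (auto simp: Dinf_mult)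
  show "\<one>\<^bsub>Dinf\<^esub> \<otimes>\<^bsub>Dinf\<^esub> x = x"
    by (cases x) (simp add: Dinf_mult Dinf_one)
  obtain i s where "x = (i, s)" by (cases x)
  then have "(if s then i else - i, s) \<otimes>\<^bsub>Dinf\<^esub> x = \<one>\<^bsub>Dinf\<^esub>"
    by (simp add: Dinf_mult Dinf_one)
  then show "\<exists>y \<in> carrier Dinf. y \<otimes>\<^bsub>Dinf\<^esub> x = \<one>\<^bsub>Dinf\<^esub>"
    using Dinf_carrier by blast
qed (simp_all add: Dinf_carrier)

lemma Dinf_inv: "inv\<^bsub>Dinf\<^esub> (i, s) = (if s then i else - i, s)"
  by (rule group.inv_equality[OF group_Dinf]) (auto simp: Dinf_mult Dinf_one Dinf_carrier)

lemma Dinf_relations: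
  "Dinf_a \<otimes>\<^bsub>Dinf\<^esub> Dinf_b = Dinf_b \<otimes>\<^bsub>Dinf\<^esub> inv\<^bsub>Dinf\<^esub> Dinf_a"
  "Dinf_b \<otimes>\<^bsub>Dinf\<^esub> Dinf_b = \<one>\<^bsub>Dinf\<^esub>"
  by (simp_all add: Dinf_a_def Dinf_b_def Dinf_inv Dinf_mult Dinf_one)

lemma Dinf_nat_pow: "Dinf_a [^]\<^bsub>Dinf\<^esub> (n::nat) = (int n, False)"
proof (induction n)
  case (Suc n)
  have "Dinf_a [^]\<^bsub>Dinf\<^esub> Suc n = (int n, False) \<otimes>\<^bsub>Dinf\<^esub> (1, False)"
    by (simp only: nat_pow_Suc Suc.IH flip: Dinf_a_def)
  then show ?case by (simp add: Dinf_mult)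
qed (simp add: Dinf_one)

lemma Dinf_int_pow: "Dinf_a [^]\<^bsub>Dinf\<^esub> (i::int) = (i, False)"
proof (cases "i < 0")
  case True
  then have "Dinf_a [^]\<^bsub>Dinf\<^esub> i = inv\<^bsub>Dinf\<^esub> (Dinf_a [^]\<^bsub>Dinf\<^esub> nat (- i))"
    by (simp only: int_pow_def2 if_True)
  with True show ?thesis by (simp add: Dinf_nat_pow Dinf_inv)
next
  case False
  then have "Dinf_a [^]\<^bsub>Dinf\<^esub> i = Dinf_a [^]\<^bsub>Dinf\<^esub> nat i"
    by (simp only: int_pow_def2 if_False)
  with False show ?thesis by (simp add: Dinf_nat_pow)
qed

lemma Dinf_normal_form: "Dinf_lift Dinf Dinf_a Dinf_b (i, s) = (i, s)"
  by (simp add: Dinf_lift_def Dinf_int_pow Dinf_b_def Dinf_mult Dinf_one)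

context group
begin

lemma flip_int_pow:
  assumes [simp]: "x \<in> carrier G" "y \<in> carrier G"
    and rel: "x \<otimes> y = y \<otimes> inv x"
  shows "x [^] (i::int) \<otimes> y = y \<otimes> x [^] (- i)"
proof -
  have nat: "z [^] (n::nat) \<otimes> y = y \<otimes> w [^] n"
    if [simp]: "z \<in> carrier G" "w \<in> carrier G" and zw: "z \<otimes> y = y \<otimes> w" for z w n
  proof (induction n)
    case (Suc n)
    have "z [^] Suc n \<otimes> y = z [^] n \<otimes> (z \<otimes> y)" by (simp add: m_assoc)
    also have "\<dots> = z [^] n \<otimes> y \<otimes> w" by (simp add: zw m_assoc)
    also have "\<dots> = y \<otimes> w [^] Suc n" by (simp add: Suc m_assoc)
    finally show ?case .
  qed simp
  have "inv x \<otimes> y = y \<otimes> x"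
  proof -
    have "inv x \<otimes> y \<otimes> inv x = inv x \<otimes> (x \<otimes> y)"
      by (simp only: rel) (simp add: m_assoc)
    also have "\<dots> = y"
      using m_assoc[of "inv x" x y] by simp
    finally have "y \<otimes> x = inv x \<otimes> y \<otimes> inv x \<otimes> x" by (simp only:)
    also have "\<dots> = inv x \<otimes> y" by (simp add: m_assoc)
    finally show ?thesis ..
  qed
  note neg = nat[OF _ _ this, of "nat (- i)"] and pos = nat[OF _ _ rel, of "nat i"]
  show ?thesis
  proof (cases "i < 0")
    case True
    then have "x [^] i = inv x [^] nat (- i)" "x [^] (- i) = x [^] nat (- i)"
      by (auto simp: int_pow_def2 nat_pow_inv simp del: pow_nat)
    with neg show ?thesis by (simp del: pow_nat)
  next
    case False
    then have "x [^] i = x [^] nat i" "x [^] (- i) = inv x [^] nat i"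
      by (auto simp: int_pow_def2 nat_pow_inv simp del: pow_nat)
    with pos show ?thesis by (simp del: pow_nat)
  qed
qed

text \<open>The universal property of the presentation \<open>\<langle>a, b : ab = ba\<^sup>-\<^sup>1, b\<^sup>2 = 1\<rangle>\<close>.\<close>

lemma Dinf_lift_hom:
  assumes [simp]: "x \<in> carrier G" "y \<in> carrier G"
    and rel: "x \<otimes> y = y \<otimes> inv x" and y2: "y \<otimes> y = \<one>"
  shows "Dinf_lift G x y \<in> hom Dinf G"
    and "Dinf_lift G x y Dinf_a = x"
    and "Dinf_lift G x y Dinf_b = y"
proof -
  have comm: "y \<otimes> x [^] j = x [^] (- j) \<otimes> y" for j :: int
    using flip_int_pow[OF assms(1-3), of "- j"] by simp
  have mult: "Dinf_lift G x y ((i, s) \<otimes>\<^bsub>Dinf\<^esub> (j, t)) =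
      Dinf_lift G x y (i, s) \<otimes> Dinf_lift G x y (j, t)" for i j s t
  proof (cases s)
    case False
    then show ?thesis by (auto simp: Dinf_mult Dinf_lift_def int_pow_mult m_assoc)
  next
    case True
    have "x [^] i \<otimes> y \<otimes> (x [^] j \<otimes> z) = x [^] (i - j) \<otimes> (y \<otimes> z)"
      if [simp]: "z \<in> carrier G" for z
    proof -
      have "x [^] i \<otimes> y \<otimes> (x [^] j \<otimes> z) = x [^] i \<otimes> (y \<otimes> x [^] j) \<otimes> z"
        by (simp add: m_assoc)
      also have "\<dots> = (x [^] i \<otimes> x [^] (- j)) \<otimes> (y \<otimes> z)"
        by (simp only: comm) (simp add: m_assoc)
      also have "x [^] i \<otimes> x [^] (- j) = x [^] (i - j)"
        using int_pow_mult[of x i "- j"] by simp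
      finally show ?thesis .
    qed
    from this[of y] this[of \<one>] True show ?thesis
      by (auto simp: Dinf_mult Dinf_lift_def y2)
  qed
  then show "Dinf_lift G x y \<in> hom Dinf G"
    by (auto simp: hom_def Dinf_lift_def)
  show "Dinf_lift G x y Dinf_a = x" "Dinf_lift G x y Dinf_b = y"
    by (auto simp: Dinf_lift_def Dinf_a_def Dinf_b_def int_pow_def2)
qed

lemma Dinf_lift_unique:
  assumes f: "f \<in> hom Dinf G"
  shows "f = Dinf_lift G (f Dinf_a) (f Dinf_b)"
proof
  interpret D: group Dinf by (rule group_Dinf)
  interpret h: group_hom Dinf G f
    using f by unfold_locales
  fix g :: "int \<times> bool"
  obtain i s where g: "g = (i, s)" by (cases g)
  note [simp] = Dinf_carrier
  have "f g = f (Dinf_lift Dinf Dinf_a Dinf_b (i, s))"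
    by (simp only: Dinf_normal_form g)
  also have "\<dots> = Dinf_lift G (f Dinf_a) (f Dinf_b) g"
    by (auto simp: Dinf_lift_def g h.hom_int_pow)
  finally show "f g = Dinf_lift G (f Dinf_a) (f Dinf_b) g" .
qed

end

lemma restrict_mem_BijGroup:
  assumes "bij_betw f S S"
  shows "restrict f S \<in> carrier (BijGroup S)"
  using bij_betw_restrict_eq[of f S S] assms by (simp add: BijGroup_def Bij_def)

lemma BijGroup_mult:
  "f \<in> carrier (BijGroup S) \<Longrightarrow> g \<in> carrier (BijGroup S) \<Longrightarrow>
    f \<otimes>\<^bsub>BijGroup S\<^esub> g = compose S f g"
  by (simp add: BijGroup_def)

lemma flip_system_bij:
  assumes "flip_system X T \<phi>"
  shows "bij_betw T (topspace X) (topspace X)" and "bij_betw \<phi> (topspace X) (topspace X)"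
  using assms
  by (auto simp: flip_system_def homeomorphic_eq_everything_map bij_betw_def)

lemma int_iterate_of_nat:
  assumes "bij_betw T (topspace X) (topspace X)" and x: "x \<in> topspace X"
  shows "int_iterate X T (int n) x = (T ^^ n) x"
proof -
  let ?S = "topspace X" and ?T = "restrict T (topspace X)"
  interpret B: group "BijGroup ?S" by (rule group_BijGroup)
  have T: "?T \<in> carrier (BijGroup ?S)"
    using assms(1) by (rule restrict_mem_BijGroup)
  have "(?T [^]\<^bsub>BijGroup ?S\<^esub> n) x = (T ^^ n) x \<and> (T ^^ n) x \<in> ?S" using x
  proof (induction n arbitrary: x)
    case 0
    then show ?case by (simp) (simp add: BijGroup_def)
  next
    case (Suc n)
    have Tx: "T x \<in> ?S" using Suc.prems assms(1) by (auto simp: bij_betw_def)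
    have "(?T [^]\<^bsub>BijGroup ?S\<^esub> Suc n) x = (?T [^]\<^bsub>BijGroup ?S\<^esub> n) (T x)"
      using Suc.prems BijGroup_mult[OF B.nat_pow_closed[OF T] T, of n]
      by (simp add: compose_def)
    with Suc.IH[OF Tx] show ?case by (simp only: funpow_Suc_right o_apply)
  qed
  then show ?thesis by (simp add: int_iterate_def int_pow_int)
qed

lemma flip_system_compose:
  assumes "flip_system X T \<phi>"
  shows "flip_system X T (T \<circ> \<phi>)"
proof -
  let ?S = "topspace X"
  have T: "homeomorphic_map X X T" and F: "homeomorphic_map X X \<phi>"
    and TF: "\<And>x. x \<in> ?S \<Longrightarrow> \<phi> (T x) = inv_into ?S T (\<phi> x)"
    and FF: "\<And>x. x \<in> ?S \<Longrightarrow> \<phi> (\<phi> x) = x"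
    using assms by (auto simp: flip_system_def)
  have im: "T ` ?S = ?S" "\<phi> ` ?S = ?S" "inj_on T ?S"
    using T F by (auto simp: homeomorphic_imp_surjective_map homeomorphic_imp_injective_map)
  have FS: "\<phi> x \<in> ?S" if "x \<in> ?S" for x using im that by blast
  have TS: "T x \<in> ?S" if "x \<in> ?S" for x using im that by blast
  have TTF: "T (\<phi> (T x)) = \<phi> x" if "x \<in> ?S" for x
    using im FS[OF that] TF[OF that] by (simp add: f_inv_into_f)
  have "(T \<circ> \<phi>) (T x) = inv_into ?S T ((T \<circ> \<phi>) x)" if "x \<in> ?S" for x
    using TTF[OF that] im FS[OF that] by simp
  moreover have "(T \<circ> \<phi>) ((T \<circ> \<phi>) x) = x" if "x \<in> ?S" for x
    using TTF[OF FS[OF that]] FF[OF that] by simp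
  ultimately show ?thesis
    using homeomorphic_map_compose[OF F T] T by (simp add: flip_system_def)
qed

lemma flip_system_action:
  assumes "flip_system X T \<phi>"
  shows "group_action Dinf (topspace X) (flip_action X T \<phi>)"
    and "\<And>x. x \<in> topspace X \<Longrightarrow> flip_action X T \<phi> Dinf_a x = T x"
    and "\<And>x. x \<in> topspace X \<Longrightarrow> flip_action X T \<phi> Dinf_b x = \<phi> x"
proof -
  let ?S = "topspace X"
  let ?B = "BijGroup ?S"
  let ?T = "restrict T ?S" and ?F = "restrict \<phi> ?S"
  interpret B: group ?B by (rule group_BijGroup)
  note bij = flip_system_bij[OF assms]
  note mem = bij[THEN restrict_mem_BijGroup] and mult = BijGroup_mult
  have im: "x \<in> ?S \<Longrightarrow> T x \<in> ?S" "x \<in> ?S \<Longrightarrow> \<phi> x \<in> ?S" for x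
    using bij by (auto simp: bij_betw_def)
  have FT: "T (\<phi> (T x)) = \<phi> x" if "x \<in> ?S" for x
  proof -
    have "\<phi> x \<in> T ` ?S"
      using im(2)[OF that] bij(1) by (simp add: bij_betw_def)
    then show ?thesis
      using assms that by (simp add: flip_system_def f_inv_into_f)
  qed
  have one: "\<one>\<^bsub>?B\<^esub> = (\<lambda>x\<in>?S. x)" by (simp add: BijGroup_def)
  have y2: "?F \<otimes>\<^bsub>?B\<^esub> ?F = \<one>\<^bsub>?B\<^esub>"
    unfolding mult[OF mem(2) mem(2)] one
    using assms im by (intro ext) (simp add: compose_def flip_system_def)
  have "?T \<otimes>\<^bsub>?B\<^esub> ?F \<otimes>\<^bsub>?B\<^esub> ?T = ?F"
    using im FT
    by (subst mult[OF B.m_closed[OF mem] mem(1)], subst mult[OF mem], intro ext)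
      (simp add: compose_def)
  then have "?T \<otimes>\<^bsub>?B\<^esub> ?F = ?F \<otimes>\<^bsub>?B\<^esub> inv\<^bsub>?B\<^esub> ?T"
    using B.inv_solve_right[OF B.m_closed[OF mem] mem(2,1)] by simp
  note lift = B.Dinf_lift_hom[OF mem this y2, folded flip_action_def]
  show "group_action Dinf ?S (flip_action X T \<phi>)"
    using lift(1) group_Dinf B.group_axioms
    by (simp add: group_action_def group_hom_def group_hom_axioms_def)
  show "\<And>x. x \<in> ?S \<Longrightarrow> flip_action X T \<phi> Dinf_a x = T x"
       "\<And>x. x \<in> ?S \<Longrightarrow> flip_action X T \<phi> Dinf_b x = \<phi> x"
    by (simp_all add: lift)
qed

text \<open>
  The infinite sum defining the Lind zeta function of a \<open>Dinf\<close>-action converges, with the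
  expected coefficients, because \<open>Dinf\<close> has finitely many subgroups of each finite index.
\<close>

lemma Dinf_finitely_many_subgroups:
  "finite {H \<in> finite_index_subgroups Dinf. card (lcosets\<^bsub>Dinf\<^esub> H) = n}"
proof -
  interpret D: group Dinf by (rule group_Dinf)
  note [simp] = Dinf_carrier
  define N where "N = int (fact n)"
  define K where "K = {0..<N} \<times> (UNIV :: bool set)"
  have "N > 0" by (simp add: N_def)
  have period: "(i + N * k, s) \<in> H \<longleftrightarrow> (i, s) \<in> H"
    if "H \<in> finite_index_subgroups Dinf" and n: "card (lcosets\<^bsub>Dinf\<^esub> H) = n" for H i k s
  proof -
    have H: "subgroup H Dinf" and fin: "finite (lcosets\<^bsub>Dinf\<^esub> H)"
      using that by (auto simp: finite_index_subgroups_def)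
    define c where "c = (\<lambda>j. (int j, False) <#\<^bsub>Dinf\<^esub> H)"
    have "c ` {0..n} \<subseteq> lcosets\<^bsub>Dinf\<^esub> H" by (auto simp: c_def LCOSETS_def)
    then have "card (c ` {0..n}) \<le> n" using card_mono[OF fin] n by blast
    then have "\<not> inj_on c {0..n}" by (auto dest: card_image)
    then obtain p q where pq: "p < q" "q \<le> n" "c p = c q"
      unfolding inj_on_def by (metis atLeastAtMost_iff linorder_neqE_nat)
    have "(int q, False) \<in> c p"
      using D.lcos_self[OF _ H, of "(int q, False)"] pq(3) by (simp add: c_def)
    then obtain h where h: "h \<in> H" "(int q, False) = (int p, False) \<otimes>\<^bsub>Dinf\<^esub> h"
      by (auto simp: c_def l_coset_def)
    then have d: "(int (q - p), False) \<in> H"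
      using pq(1) by (cases h) (auto simp: Dinf_mult)
    have mult: "(int (q - p) * int j, False) \<in> H" for j
    proof (induction j)
      case 0
      then show ?case using subgroup.one_closed[OF H] by (simp add: Dinf_one)
    next
      case (Suc j)
      from subgroup.m_closed[OF H this d] show ?case by (simp add: Dinf_mult algebra_simps)
    qed
    have "q - p dvd fact n" using pq by (intro dvd_fact) auto
    then obtain e where "fact n = (q - p) * e" by (rule dvdE)
    then have e: "N = int (q - p) * int e" by (simp only: N_def of_nat_mult)
    have pos: "(N * int j, False) \<in> H" for j
      using mult[of "e * j"] by (simp add: e mult.assoc)
    have per: "(N * k, False) \<in> H" for k
    proof (cases "k \<ge> 0")
      case True
      then show ?thesis using pos[of "nat k"] by simp
    next
      case False
      then show ?thesis
        using subgroup.m_inv_closed[OF H pos[of "nat (- k)"]] by (simp add: Dinf_inv)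
    qed
    show ?thesis
    proof
      assume "(i, s) \<in> H"
      from subgroup.m_closed[OF H per[of k] this] show "(i + N * k, s) \<in> H"
        by (simp add: Dinf_mult add.commute)
    next
      assume "(i + N * k, s) \<in> H"
      from subgroup.m_closed[OF H per[of "- k"] this] show "(i, s) \<in> H"
        by (simp add: Dinf_mult)
    qed
  qed
  have "inj_on (\<lambda>H. H \<inter> K) {H \<in> finite_index_subgroups Dinf. card (lcosets\<^bsub>Dinf\<^esub> H) = n}"
  proof (rule inj_onI)
    fix H H'
    assume H: "H \<in> {H \<in> finite_index_subgroups Dinf. card (lcosets\<^bsub>Dinf\<^esub> H) = n}"
      and H': "H' \<in> {H \<in> finite_index_subgroups Dinf. card (lcosets\<^bsub>Dinf\<^esub> H) = n}"
      and eq: "H \<inter> K = H' \<inter> K"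
    have "(i, s) \<in> H \<longleftrightarrow> (i, s) \<in> H'" for i s
    proof -
      have K: "(i mod N, s) \<in> K" using \<open>N > 0\<close> by (simp add: K_def)
      have "(i, s) \<in> H \<longleftrightarrow> (i mod N, s) \<in> H"
        using period[of H "i mod N" "i div N" s] H by simp
      also have "\<dots> \<longleftrightarrow> (i mod N, s) \<in> H'" using eq K by blast
      also have "\<dots> \<longleftrightarrow> (i, s) \<in> H'"
        using period[of H' "i mod N" "i div N" s] H' by simp
      finally show ?thesis .
    qed
    then show "H = H'" by auto
  qed
  moreover have "finite K" by (simp add: K_def)
  ultimately show ?thesis
    by (rule_tac finite_imageD[rotated]) (auto intro: finite_subset[of _ "Pow K"])
qed

lemma lind_zeta_exponent_has_sum:
  fixes c :: "'h \<Rightarrow> rat"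
  assumes fin: "\<And>n. finite {H \<in> A. d H = n}"
  shows "((\<lambda>H. fps_const (c H) * fps_X ^ d H) has_sum
           Abs_fps (\<lambda>n. \<Sum>H | H \<in> A \<and> d H = n. c H)) A"
  unfolding has_sum_def
proof (rule tendsto_fpsI)
  fix n
  have "fps_nth (\<Sum>H\<in>Y. fps_const (c H) * fps_X ^ d H) n = (\<Sum>H | H \<in> A \<and> d H = n. c H)"
    if "finite Y" "{H \<in> A. d H = n} \<subseteq> Y" "Y \<subseteq> A" for Y
  proof -
    have "fps_nth (\<Sum>H\<in>Y. fps_const (c H) * fps_X ^ d H) n = (\<Sum>H\<in>Y. if d H = n then c H else 0)"
      by (auto simp: fps_sum_nth fps_X_power_iff intro!: sum.cong)
    also have "\<dots> = (\<Sum>H | H \<in> Y \<and> d H = n. c H)"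
      using that(1) by (simp add: sum.inter_filter)
    also have "{H. H \<in> Y \<and> d H = n} = {H. H \<in> A \<and> d H = n}" using that by auto
    finally show ?thesis .
  qed
  then show "\<forall>\<^sub>F Y in finite_subsets_at_top A.
      fps_nth (\<Sum>H\<in>Y. fps_const (c H) * fps_X ^ d H) n =
      fps_nth (Abs_fps (\<lambda>n. \<Sum>H | H \<in> A \<and> d H = n. c H)) n"
    unfolding eventually_finite_subsets_at_top using fin[of n]
    by (intro exI[of _ "{H \<in> A. d H = n}"]) auto
qed

lemma lind_zeta_Dinf:
  "lind_zeta Dinf E \<alpha> = fps_compose (fps_exp 1) (Abs_fps (\<lambda>n.
     \<Sum>H | H \<in> finite_index_subgroups Dinf \<and> card (lcosets\<^bsub>Dinf\<^esub> H) = n.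
       of_nat (card (common_fixed_points E \<alpha> H)) / of_nat (card (lcosets\<^bsub>Dinf\<^esub> H))))"
  unfolding lind_zeta_def
  by (subst infsumI[OF lind_zeta_exponent_has_sum[OF Dinf_finitely_many_subgroups]]) (rule refl)

end

theory Submission
  imports Defs
begin

text \<open>
  The flip \<open>T \<circ> \<phi>\<close> is the image of \<open>ab\<close>, and \<open>a \<mapsto> a\<close>, \<open>b \<mapsto> ab\<close> defines an automorphism of
  \<open>Dinf\<close>. Hence the two actions differ by an automorphism, which permutes the subgroups of finite
  index and preserves the index, so the zeta functions agree. The numbers of flip points agree
  because \<open>T ^^ k (\<phi> (T ^^ k x)) = \<phi> x\<close>, so that a suitable power of \<open>T\<close>, namely \<open>T ^^ m\<close>, \<open>T\<close> and
  the identity in the three cases, maps the one set onto the other.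
\<close>

text \<open>A homomorphism maps the coset of \<open>g\<close> onto the coset of
  \<open>\<sigma> g\<close>, and by surjectivity of \<open>\<sigma>\<close> every coset in
  \<open>G'\<close> has a representative \<open>\<sigma> g\<close>.\<close>

lemma lcosets_iso_image:
  assumes "\<sigma> \<in> iso G G'" and "H \<subseteq> carrier G"
  shows "lcosets\<^bsub>G'\<^esub> (\<sigma> ` H) = image \<sigma> ` (lcosets\<^bsub>G\<^esub> H)"
proof -
  have hom: "\<sigma> \<in> hom G G'" and surj: "\<sigma> ` carrier G = carrier G'"
    using assms(1) by (auto simp: iso_def bij_betw_def)
  have "\<sigma> g <#\<^bsub>G'\<^esub> \<sigma> ` H = \<sigma> ` (g <#\<^bsub>G\<^esub> H)" if "g \<in> carrier G" for g
    using that assms(2) hom_mult[OF hom that] by (force simp: l_coset_def)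
  then show ?thesis
    unfolding LCOSETS_def surj[symmetric] by auto
qed

lemma card_lcosets_iso_image:
  assumes "group G" and "\<sigma> \<in> iso G G'" and "H \<subseteq> carrier G"
  shows "card (lcosets\<^bsub>G'\<^esub> (\<sigma> ` H)) = card (lcosets\<^bsub>G\<^esub> H)"
proof -
  interpret G: group G by fact
  have "lcosets\<^bsub>G\<^esub> H \<subseteq> Pow (carrier G)"
    using G.l_coset_subset_G[OF assms(3)] by (auto simp: LCOSETS_def)
  moreover have "inj_on \<sigma> (carrier G)"
    using assms(2) by (simp add: iso_def bij_betw_def)
  ultimately have "inj_on (image \<sigma>) (lcosets\<^bsub>G\<^esub> H)"
    using inj_on_image_Pow inj_on_subset by blast
  then show ?thesis
    by (simp add: lcosets_iso_image[OF assms(2,3)] card_image)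
qed

lemma finite_index_subgroups_iso_image:
  assumes "group G" and "group G'" and "\<sigma> \<in> iso G G'" and "H \<in> finite_index_subgroups G"
  shows "\<sigma> ` H \<in> finite_index_subgroups G'"
proof -
  interpret group_hom G G' \<sigma>
    using assms(1-3) by (simp add: group_hom_def group_hom_axioms_def iso_def)
  show ?thesis
    using assms(4) lcosets_iso_image[OF assms(3) subgroup.subset, of H] subgroup_img_is_subgroup
    by (simp add: finite_index_subgroups_def)
qed

text \<open>The inverse isomorphism is again an isomorphism, so taking images under it inverts
  taking images under \<open>\<sigma>\<close>.\<close>

lemma bij_betw_finite_index_subgroups:
  assumes "group G" and "group G'" and "\<sigma> \<in> iso G G'"
  shows "bij_betw (image \<sigma>) (finite_index_subgroups G) (finite_index_subgroups G')"
proof -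
  let ?\<tau> = "inv_into (carrier G) \<sigma>"
  have \<tau>: "?\<tau> \<in> iso G' G"
    by (rule group.iso_set_sym[OF assms(1,3)])
  have bij: "inj_on \<sigma> (carrier G)" "\<sigma> ` carrier G = carrier G'"
    using assms(3) by (auto simp: iso_def bij_betw_def)
  show ?thesis
  proof (rule bij_betw_byWitness[where f' = "image ?\<tau>"])
    show "\<forall>H \<in> finite_index_subgroups G. ?\<tau> ` \<sigma> ` H = H"
      using bij(1) by (simp add: finite_index_subgroups_def subgroup.subset inv_into_image_cancel)
    show "\<forall>H \<in> finite_index_subgroups G'. \<sigma> ` ?\<tau> ` H = H"
      by (simp add: finite_index_subgroups_def subgroup.subset image_inv_into_cancel[OF bij(2)])
  qed (use finite_index_subgroups_iso_image[OF assms(1,2,3)]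
      finite_index_subgroups_iso_image[OF assms(2,1) \<tau>] in auto)
qed

lemma common_fixed_points_comp:
  "common_fixed_points E (\<alpha> \<circ> \<sigma>) H = common_fixed_points E \<alpha> (\<sigma> ` H)"
  by (auto simp: common_fixed_points_def)

text \<open>The exponent is reindexed along the bijection that sends \<open>H\<close> to its image
  under \<open>\<sigma>\<close>: index and fixed points match term by term. If the sum diverges,
  \<open>infsum\<close> takes its default value 0 on both sides.\<close>

lemma lind_zeta_iso:
  assumes "group G" and "group G'" and "\<sigma> \<in> iso G G'"
  shows "lind_zeta G E (\<alpha> \<circ> \<sigma>) = lind_zeta G' E \<alpha>"
proof -
  have "card (lcosets\<^bsub>G'\<^esub> (\<sigma> ` H)) = card (lcosets\<^bsub>G\<^esub> H)" if "H \<in> finite_index_subgroups G" for H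
    using that card_lcosets_iso_image[OF assms(1,3) subgroup.subset]
    by (simp add: finite_index_subgroups_def)
  then show ?thesis
    unfolding lind_zeta_def
    by (subst infsum_reindex_bij_betw[OF bij_betw_finite_index_subgroups[OF assms], symmetric])
      (simp add: common_fixed_points_comp cong: infsum_cong)
qed

text \<open>In normal form, fixing \<open>a\<close> and sending \<open>b\<close> to
  \<open>ab\<close> takes \<open>a^i b\<close> to \<open>a^(i+1) b\<close>.\<close>

definition Dinf_shift :: "int \<times> bool \<Rightarrow> int \<times> bool" where
  "Dinf_shift = (\<lambda>(i, s). (if s then i + 1 else i, s))"

lemma Dinf_shift_iso: "Dinf_shift \<in> iso Dinf Dinf"
proof -
  have "bij Dinf_shift"
    by (rule bij_betw_byWitness[where f' = "\<lambda>(i, s). (if s then i - 1 else i, s)"])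
      (auto simp: Dinf_shift_def)
  then show ?thesis
    by (auto simp: iso_def hom_def Dinf_def Dinf_shift_def split: if_splits)
qed

text \<open>On rotations both sides are powers of \<open>T\<close>; on a reflection
  \<open>a^i b\<close> the extra factor \<open>T\<close> of the new flip is absorbed into the power,
  which becomes \<open>T^(i+1)\<close>.\<close>

lemma flip_action_comp:
  assumes "flip_system X T \<phi>"
  shows "flip_action X T (T \<circ> \<phi>) = flip_action X T \<phi> \<circ> Dinf_shift"
proof -
  let ?S = "topspace X"
  interpret B: group "BijGroup ?S" by (rule group_BijGroup)
  note bij = flip_system_bij[OF assms]
  note mem = bij[THEN restrict_mem_BijGroup]
  have "restrict (T \<circ> \<phi>) ?S = restrict T ?S \<otimes>\<^bsub>BijGroup ?S\<^esub> restrict \<phi> ?S"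
    using bij(2) by (intro ext) (auto simp: BijGroup_mult[OF mem] compose_def bij_betw_def)
  then show ?thesis
    using mem
    by (intro ext) (auto simp: flip_action_def Dinf_lift_def Dinf_shift_def B.int_pow_mult B.m_assoc
        B.int_pow_1)
qed

lemma card_of_Collect_bij:
  assumes f: "bij_betw f S S" and PQ: "\<And>x. x \<in> S \<Longrightarrow> P x \<longleftrightarrow> Q (f x)"
  shows "|{x \<in> S. P x}| =o |{x \<in> S. Q x}|"
proof -
  have "f ` {x \<in> S. P x} = {y \<in> f ` S. Q y}"
    using PQ by auto
  then have "f ` {x \<in> S. P x} = {y \<in> S. Q y}"
    by (simp only: bij_betw_imp_surj_on[OF f])
  with f have "bij_betw f {x \<in> S. P x} {x \<in> S. Q x}"
    by (auto simp: bij_betw_def elim: inj_on_subset)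
  then show ?thesis using card_of_ordIso by blast
qed

text \<open>Conjugation by \<open>\<phi>\<close> turns \<open>T ^^ k\<close> into its inverse; this
  form of the relation avoids inverses. The induction hypothesis is used at \<open>T x\<close>,
  which leaves the case of a single \<open>T\<close> on each side of \<open>\<phi>\<close>.\<close>

lemma flip_funpow:
  assumes "flip_system X T \<phi>" and "x \<in> topspace X"
  shows "(T ^^ k) (\<phi> ((T ^^ k) x)) = \<phi> x"
  using assms(2)
proof (induction k arbitrary: x)
  case (Suc k)
  note bij = flip_system_bij[OF assms(1)]
  have "\<phi> x \<in> T ` topspace X" "T x \<in> topspace X"
    using bij Suc.prems by (auto simp: bij_betw_def)
  then have "T (\<phi> (T x)) = \<phi> x"
    using assms(1) Suc.prems by (simp add: flip_system_def f_inv_into_f)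
  moreover have "(T ^^ Suc k) (\<phi> ((T ^^ Suc k) x)) = T ((T ^^ k) (\<phi> ((T ^^ k) (T x))))"
    by (simp only: funpow.simps funpow_swap1 o_apply)
  ultimately show ?case
    using Suc.IH[OF \<open>T x \<in> topspace X\<close>] by simp
qed simp

theorem proposition4p1:
  fixes X :: "'a topology" and T \<phi> :: "'a \<Rightarrow> 'a"
  assumes "flip_system X T \<phi>"
  shows "(\<forall>m::nat. m \<ge> 1 \<longrightarrow>
            flip_points X T \<phi> (2 * m - 1) 0 =o flip_points X T (T \<circ> \<phi>) (2 * m - 1) 0 \<and>
            flip_points X T \<phi> (2 * m) 0 =o flip_points X T (T \<circ> \<phi>) (2 * m) 1 \<and>
            flip_points X T \<phi> (2 * m) 1 =o flip_points X T (T \<circ> \<phi>) (2 * m) 0) \<and>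
         ((\<forall>H \<in> finite_index_subgroups Dinf.
              finite (common_fixed_points (topspace X) (flip_action X T \<phi>) H)) \<longrightarrow>
          (\<forall>H \<in> finite_index_subgroups Dinf.
              finite (common_fixed_points (topspace X) (flip_action X T (T \<circ> \<phi>)) H)) \<and>
          lind_zeta Dinf (topspace X) (flip_action X T \<phi>) =
          lind_zeta Dinf (topspace X) (flip_action X T (T \<circ> \<phi>)))"
proof (intro conjI allI impI)
  let ?S = "topspace X"
  note bij = flip_system_bij[OF assms]
  have \<phi>S: "\<phi> x \<in> ?S" and TS: "T x \<in> ?S" and kS: "(T ^^ k) x \<in> ?S" if "x \<in> ?S" for x k
    using that bij bij_betw_funpow[OF bij(1), of k] by (auto simp: bij_betw_def)
  have inj: "(T ^^ k) x = (T ^^ k) y \<longleftrightarrow> x = y" if "x \<in> ?S" "y \<in> ?S" for x y k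
    using that bij_betw_funpow[OF bij(1), of k] by (auto simp: bij_betw_def inj_on_def)
  have pts: "flip_points X T \<psi> n 0 = |{x \<in> ?S. (T ^^ n) x = x \<and> \<psi> x = x}|"
    "flip_points X T \<psi> n 1 = |{x \<in> ?S. (T ^^ n) x = x \<and> T (\<psi> x) = x}|"
    if "bij_betw \<psi> ?S ?S" for \<psi> n
    unfolding flip_points_def
    using int_iterate_of_nat[OF bij(1) bij_betw_apply[OF that], of _ 0]
      int_iterate_of_nat[OF bij(1) bij_betw_apply[OF that], of _ 1]
    by (simp_all cong: conj_cong)
  note pts = pts[OF bij(2)] pts[OF bij_betw_trans[OF bij(2,1)]]
  have funpow_funpow: "(T ^^ n) ((T ^^ k) x) = (T ^^ k) ((T ^^ n) x)" for x n k
    by (metis add.commute comp_apply funpow_add)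
  \<comment> \<open>\<open>T ^^ k\<close> commutes with \<open>T ^^ n\<close> and is injective on
    the space.\<close>
  have periodic: "(T ^^ n) ((T ^^ k) x) = (T ^^ k) x \<longleftrightarrow> (T ^^ n) x = x" if "x \<in> ?S" for x n k
    using inj[of "(T ^^ n) x" x k] kS that by (simp only: funpow_funpow[of n k])
  fix m :: nat assume "m \<ge> 1"
  then obtain l where m: "m = Suc l" by (cases m) auto
  show "flip_points X T \<phi> (2 * m - 1) 0 =o flip_points X T (T \<circ> \<phi>) (2 * m - 1) 0"
    unfolding pts
  proof (rule card_of_Collect_bij[OF bij_betw_funpow[OF bij(1), of m]])
    fix x assume x: "x \<in> ?S"
    let ?y = "(T ^^ m) x"
    \<comment> \<open>With \<open>l = m - 1\<close>, applying \<open>T ^^ l\<close> completes the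
      left side to \<open>T ^^ m\<close> around \<open>\<phi>\<close>, hence to
      \<open>\<phi> x\<close>. The right side becomes the power \<open>l + m = 2 * m - 1\<close> at
      \<open>x\<close>, which is \<open>x\<close> when \<open>x\<close> has that period.\<close>
    have "T (\<phi> ?y) = ?y \<longleftrightarrow> (T ^^ l) (T (\<phi> ?y)) = (T ^^ l) ?y"
      using inj TS \<phi>S kS x by simp
    also have "(T ^^ l) (T (\<phi> ?y)) = \<phi> x"
      using flip_funpow[OF assms x, where k = m] by (simp add: m funpow_swap1)
    also have "(T ^^ l) ?y = (T ^^ (2 * m - 1)) x"
      by (simp add: m mult_2 flip: funpow_add o_apply[of "T ^^ l" "T ^^ Suc l"] del: funpow.simps)
    finally show "(T ^^ (2 * m - 1)) x = x \<and> \<phi> x = x \<longleftrightarrow>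
        (T ^^ (2 * m - 1)) ?y = ?y \<and> (T \<circ> \<phi>) ?y = ?y"
      using periodic[OF x] by auto
  qed
  show "flip_points X T \<phi> (2 * m) 0 =o flip_points X T (T \<circ> \<phi>) (2 * m) 1"
    unfolding pts
  proof (rule card_of_Collect_bij[OF bij(1)])
    fix x assume x: "x \<in> ?S"
    show "(T ^^ (2 * m)) x = x \<and> \<phi> x = x \<longleftrightarrow>
        (T ^^ (2 * m)) (T x) = T x \<and> T ((T \<circ> \<phi>) (T x)) = T x"
      \<comment> \<open>Since \<open>T (\<phi> (T x)) = \<phi> x\<close>, the last condition reads
        \<open>T (\<phi> x) = T x\<close>, and \<open>T\<close> cancels.\<close>
      using periodic[OF x, where k = 1] flip_funpow[OF assms x, where k = 1] inj[OF \<phi>S x, where k = 1] x by simp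
  qed
  show "flip_points X T \<phi> (2 * m) 1 =o flip_points X T (T \<circ> \<phi>) (2 * m) 0"
    \<comment> \<open>Here both sets are the same: each asks for period \<open>2 * m\<close> and
      \<open>T (\<phi> x) = x\<close>.\<close>
    unfolding pts by (simp add: card_of_refl)
next
  assume fin: "\<forall>H \<in> finite_index_subgroups Dinf.
    finite (common_fixed_points (topspace X) (flip_action X T \<phi>) H)"
  show "\<forall>H \<in> finite_index_subgroups Dinf.
    finite (common_fixed_points (topspace X) (flip_action X T (T \<circ> \<phi>)) H)"
    \<comment> \<open>The points fixed by \<open>H\<close> under the new action are those fixed by
      its image under \<open>Dinf_shift\<close> under the old one.\<close>
    using fin finite_index_subgroups_iso_image[OF group_Dinf group_Dinf Dinf_shift_iso]
    by (simp add: flip_action_comp[OF assms] common_fixed_points_comp)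
next
  show "lind_zeta Dinf (topspace X) (flip_action X T \<phi>) =
    lind_zeta Dinf (topspace X) (flip_action X T (T \<circ> \<phi>))"
    by (simp add: flip_action_comp[OF assms] lind_zeta_iso[OF group_Dinf group_Dinf Dinf_shift_iso])
qed

end
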